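(* For each positive integer $g$, let $\mu_g$ be the infinite lower-triangular matrix defined by $(\mu_g)_{i,j\ge 1}:=M_g(i+g,j+g)$ and let $\gamma_g$ be the infinite lower-triangular matrix defined by $(\gamma_g)_{i,j\ge 1}:=K_g(i-j,j)$. Then $\mu_g$ and $\gamma_g$ are inverses of one another.
   Context: A partition $\lambda=(\lambda_1,\ldots,\lambda_{\ell(\lambda)})$ of a natural number $n$ is a nondecreasing finite sequence of positive integers $\lambda_1\le\lambda_2\le\cdots\le\lambda_{\ell(\lambda)}$ with sum $|\lambda|=n$; $\ell(\lambda)$ is its number of parts. A composition $\kappa=(\kappa_1,\ldots,\kappa_{\ell(\kappa)})$ of $n$ is a finite sequence of positive integers (in any order) with sum $|\kappa|=n$; $\ell(\kappa)$ is its number of parts. The empty sequence is the unique partition, and the unique composition, of $0$. For a nonnegative integer $g$, $\mathscr{P}_g$ is the set of partitions $\lambda$ with $\lambda_{i+1}-\lambda_i\ge g$ for all $1\le i\le \ell(\lambda)-1$, and $\mathscr{C}_g$ is the set of compositions $\kappa$ with $\kappa_{i+1}-\kappa_i\ge -(g-1)$ for all $1\le i\le \ell(\kappa)-1$ (both contain the empty sequence). The integers $M_g(n,m)$, $n,m\ge 1$, are defined by $$\sum_{m,n\ge 1}M_g(n,m)x^m q^n=\sum_{\lambda\in\mathscr{P}_g,\ \lambda\ne\emptyset}(-1)^{\ell(\lambda)+1}x^{\lambda_{\ell(\lambda)}}q^{|\lambda|},$$ so that $M_g(n,m)$ is the sum of $(-1)^{\ell(\lambda)+1}$ over nonempty $\lambda\in\mathscr{P}_g$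 of size $n$ with largest part $m$. For a nonnegative integer $m$, a composition $\kappa$ is called $m$-step if $\kappa_j\le m+\sum_{i=0}^{j-1}\kappa_i$ for each part $\kappa_j$ ($1\le j\le\ell(\kappa)$), with the convention $\kappa_0=0$; the empty composition is $m$-step. $K_g(n,m)$ denotes the number of $m$-step compositions of $n$ in $\mathscr{C}_g$, with $K_g(n,m)=0$ for $n<0$. Rows and columns of the matrices are indexed by the positive integers, $i$ being the row index and $j$ the column index. *)

theory Defs
  imports Main
begin

definition compositions :: "nat list set" where
  "compositions = {\<kappa>. \<forall>k\<in>set \<kappa>. 0 < k}"

definition partitions :: "nat list set" where
  "partitions = {p. (\<forall>k\<in>set p. 0 < k) \<and> sorted p}"

text \<open>Lists are indexed from 0, so the part with index \<open>i\<close> in the usual numbering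
  is \<open>p ! (i - 1)\<close>. Differences of parts are taken in the integers.\<close>

definition gap_partitions :: "nat \<Rightarrow> nat list set" where
  "gap_partitions g = {p \<in> partitions.
     \<forall>i. Suc i < length p \<longrightarrow> int (p ! Suc i) - int (p ! i) \<ge> int g}"

definition gap_compositions :: "nat \<Rightarrow> nat list set" where
  "gap_compositions g = {\<kappa> \<in> compositions.
     \<forall>i. Suc i < length \<kappa> \<longrightarrow> int (\<kappa> ! Suc i) - int (\<kappa> ! i) \<ge> - (int g - 1)}"

text \<open>The coefficient of \<open>x^m q^n\<close> in the generating function of the nonempty
  \<open>p \<in> gap_partitions g\<close>, each weighted by
  \<open>(-1)^(length p + 1) x^(last p) q^(sum_list p)\<close>. As parts are nondecreasing,
  the last part is the largest one.\<close>

definition M :: "nat \<Rightarrow> nat \<Rightarrow> nat \<Rightarrow> int" where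
  "M g n m = (\<Sum>p | p \<in> gap_partitions g \<and> p \<noteq> [] \<and> sum_list p = n \<and> last p = m.
     (- 1) ^ (length p + 1))"

definition m_step :: "nat \<Rightarrow> nat list \<Rightarrow> bool" where
  "m_step m \<kappa> \<longleftrightarrow> (\<forall>j < length \<kappa>. \<kappa> ! j \<le> m + (\<Sum>i<j. \<kappa> ! i))"

text \<open>The size is an integer; for negative \<open>n\<close> the set below is empty and \<open>K g n m = 0\<close>.\<close>

definition K :: "nat \<Rightarrow> int \<Rightarrow> nat \<Rightarrow> nat" where
  "K g n m = card {\<kappa> \<in> gap_compositions g. m_step m \<kappa> \<and> int (sum_list \<kappa>) = n}"

lemma finite_compositions_of: "finite {\<kappa> \<in> compositions. sum_list \<kappa> = n}"
proof (rule finite_subset)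
  have len: "length \<kappa> \<le> sum_list \<kappa>" if "\<forall>k\<in>set \<kappa>. 0 < k" for \<kappa> :: "nat list"
    using that by (induction \<kappa>) auto
  show "{\<kappa> \<in> compositions. sum_list \<kappa> = n} \<subseteq> {\<kappa>. set \<kappa> \<subseteq> {..n} \<and> length \<kappa> \<le> n}"
    using len by (auto simp: compositions_def member_le_sum_list)
  show "finite {\<kappa>. set \<kappa> \<subseteq> {..n} \<and> length \<kappa> \<le> n}"
    by (rule finite_lists_length_le) simp
qed

lemma finite_M_index:
  "finite {p. p \<in> gap_partitions g \<and> p \<noteq> [] \<and> sum_list p = n \<and> last p = m}"
  by (rule finite_subset[OF _ finite_compositions_of[of n]])
    (auto simp: gap_partitions_def partitions_def compositions_def)

lemma finite_K_index:
  "finite {\<kappa> \<in> gap_compositions g. m_step m \<kappa> \<and> int (sum_list \<kappa>) = n}"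
  by (rule finite_subset[OF _ finite_compositions_of[of "nat n"]])
    (auto simp: gap_compositions_def)

text \<open>An infinite integer matrix is a function of its row and column index. Only positive
  indices are meaningful; the values at index 0 are never used.\<close>

type_synonym inf_matrix = "nat \<Rightarrow> nat \<Rightarrow> int"

definition lower_triangular :: "inf_matrix \<Rightarrow> bool" where
  "lower_triangular A \<longleftrightarrow> (\<forall>i\<ge>1. \<forall>j\<ge>1. i < j \<longrightarrow> A i j = 0)"

text \<open>The sum runs over all \<open>k \<ge> 1\<close> with a nonzero contribution; for lower-triangular
  matrices these satisfy \<open>j \<le> k \<le> i\<close>, so the index set is finite.\<close>

definition mat_prod :: "inf_matrix \<Rightarrow> inf_matrix \<Rightarrow> inf_matrix" where
  "mat_prod A B i j = (\<Sum>k | 1 \<le> k \<and> A i k * B k j \<noteq> 0. A i k * B k j)"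

lemma finite_mat_prod_index:
  assumes "lower_triangular A" "1 \<le> i"
  shows "finite {k. 1 \<le> k \<and> A i k * B k j \<noteq> 0}"
  by (rule finite_subset[of _ "{..i}"])
    (use assms in \<open>auto simp: lower_triangular_def not_less[symmetric]\<close>)

definition mutually_inverse :: "inf_matrix \<Rightarrow> inf_matrix \<Rightarrow> bool" where
  "mutually_inverse A B \<longleftrightarrow>
     (\<forall>i\<ge>1. \<forall>j\<ge>1. mat_prod A B i j = (if i = j then 1 else 0)
                 \<and> mat_prod B A i j = (if i = j then 1 else 0))"

definition mu :: "nat \<Rightarrow> inf_matrix" where
  "mu g i j = M g (i + g) (j + g)"

definition gamma :: "nat \<Rightarrow> inf_matrix" where
  "gamma g i j = int (K g (int i - int j) j)"

end

theory Submission
  imports Defs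
begin

text \<open>
  Deleting the largest part \<open>k + g\<close> of a partition counted by \<open>mu g i k\<close> leaves an arbitrary
  partition with gaps at least \<open>g\<close>, of size \<open>i - k\<close> and with all parts at most \<open>k\<close>
  (\<open>mu_eq_sum_bounded_gap_partitions\<close>). Hence entry \<open>(i, j)\<close> of \<open>mu g * gamma g\<close> is a signed
  count of pairs of such a partition \<open>p\<close> and a \<open>j\<close>-step composition \<open>\<kappa>\<close> of \<open>k - j\<close> in
  \<open>gap_compositions g\<close>, where \<open>k = j + sum_list \<kappa>\<close> is determined by the pair
  (\<open>mu_gamma_eq_signed_sum\<close>).

  These pairs cancel under a sign-reversing involution that moves one part between the ends of
  the two lists. Let \<open>b\<close> be the last part of \<open>p\<close> and \<open>a\<close> the last part of \<open>\<kappa>\<close>. Appending \<open>b\<close> to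
  \<open>\<kappa>\<close> respects the condition on differences of \<open>\<kappa>\<close> iff \<open>a < b + g\<close>, and appending \<open>a\<close> to \<open>p\<close>
  respects the condition on gaps of \<open>p\<close> iff \<open>b + g \<le> a\<close>, so exactly one of the two moves is
  possible; if one list is empty, only the last part of the other can move. The bound
  \<open>b \<le> j + sum_list \<kappa>\<close> on the parts of \<open>p\<close> is the \<open>j\<close>-step condition for the new part of
  \<open>\<kappa>\<close>, and conversely (\<open>move_last_part_sign_reversing_involution\<close>). Only the pair of empty lists
  admits no move, and it occurs for \<open>i = j\<close> alone; so the product is the identity. As the
  matrices are lower triangular, a one-sided inverse is two-sided
  (\<open>lower_triangular_right_inverse_imp_left_inverse\<close>).
\<close>

section \<open>Appending a last part\<close>

lemma gap_partitions_append_iff: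
  "p @ [b] \<in> gap_partitions g \<longleftrightarrow>
     p \<in> gap_partitions g \<and> 0 < b \<and> (p = [] \<or> last p + g \<le> b)"
proof -
  have mem: "q \<in> gap_partitions g \<longleftrightarrow>
      (\<forall>k\<in>set q. 0 < k) \<and> successively (\<lambda>x y. x + g \<le> y) q" for q
  proof -
    have gaps: "(\<forall>i. Suc i < length q \<longrightarrow> int (q ! Suc i) - int (q ! i) \<ge> int g)
        \<longleftrightarrow> successively (\<lambda>x y. x + g \<le> y) q"
      unfolding successively_conv_nth by (intro iff_allI imp_cong refl) linarith
    have "sorted q" if "successively (\<lambda>x y. x + g \<le> y) q"
      using that by (auto simp: sorted_iff_nth_Suc successively_conv_nth intro: add_leD1)
    with gaps show ?thesis
      by (auto simp: gap_partitions_def partitions_def)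
  qed
  show ?thesis
    by (auto simp: mem successively_append_iff)
qed

lemma gap_compositions_append_iff:
  "\<kappa> @ [b] \<in> gap_compositions g \<longleftrightarrow>
     \<kappa> \<in> gap_compositions g \<and> 0 < b \<and> (\<kappa> = [] \<or> last \<kappa> < b + g)"
proof -
  have "(\<forall>i. Suc i < length \<kappa> \<longrightarrow> int (\<kappa> ! Suc i) - int (\<kappa> ! i) \<ge> - (int g - 1))
      \<longleftrightarrow> successively (\<lambda>x y. x < y + g) \<kappa>" for \<kappa>
    unfolding successively_conv_nth by (intro iff_allI imp_cong refl) linarith
  then have mem: "\<kappa> \<in> gap_compositions g \<longleftrightarrow>
      (\<forall>k\<in>set \<kappa>. 0 < k) \<and> successively (\<lambda>x y. x < y + g) \<kappa>" for \<kappa>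
    by (simp add: gap_compositions_def compositions_def)
  show ?thesis
    by (auto simp: mem successively_append_iff)
qed

lemma m_step_append_iff:
  "m_step m (\<kappa> @ [b]) \<longleftrightarrow> m_step m \<kappa> \<and> b \<le> m + sum_list \<kappa>"
proof -
  have "(\<Sum>i<j. (\<kappa> @ [b]) ! i) = (\<Sum>i<j. \<kappa> ! i)" if "j \<le> length \<kappa>" for j
    using that by (intro sum.cong) (auto simp: nth_append)
  then show ?thesis
    by (auto simp: m_step_def All_less_Suc nth_append sum_list_sum_nth atLeast0LessThan)
qed

section \<open>The sign-reversing involution\<close>

text \<open>The last part of \<open>p\<close> is its largest, so \<open>k\<close> bounds all parts.\<close>

definition bounded_gap_partitions :: "nat \<Rightarrow> nat \<Rightarrow> nat list set" where
  "bounded_gap_partitions g k = {p \<in> gap_partitions g. p = [] \<or> last p \<le> k}"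

definition cancelling_pairs :: "nat \<Rightarrow> nat \<Rightarrow> nat \<Rightarrow> (nat list \<times> nat list) set" where
  "cancelling_pairs g i j = {(p, \<kappa>). \<kappa> \<in> gap_compositions g \<and> m_step j \<kappa> \<and>
     p \<in> bounded_gap_partitions g (j + sum_list \<kappa>) \<and> sum_list p + (j + sum_list \<kappa>) = i}"

fun move_last_part :: "nat \<Rightarrow> nat list \<times> nat list \<Rightarrow> nat list \<times> nat list" where
  "move_last_part g (p, \<kappa>) =
     (if p \<noteq> [] \<and> (\<kappa> = [] \<or> last \<kappa> < last p + g)
      then (butlast p, \<kappa> @ [last p]) else (p @ [last \<kappa>], butlast \<kappa>))"

text \<open>After the last part \<open>b\<close> of \<open>p\<close> has moved to \<open>\<kappa>\<close>, the part before it in \<open>p\<close> is at most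
  \<open>b - g\<close>, so the same comparison now selects \<open>b\<close> for moving back. Likewise, after the last
  part \<open>a\<close> of \<open>\<kappa>\<close> has moved to \<open>p\<close>, the part before it in \<open>\<kappa>\<close> is less than \<open>a + g\<close>.\<close>

lemma move_last_part_sign_reversing_involution:
  assumes "x \<in> cancelling_pairs g i j" "x \<noteq> ([], [])"
  shows "move_last_part g x \<in> cancelling_pairs g i j"
    and "move_last_part g x \<noteq> ([], [])"
    and "move_last_part g (move_last_part g x) = x"
    and "(- 1 :: int) ^ length (fst (move_last_part g x)) = - ((- 1) ^ length (fst x))"
proof -
  obtain p \<kappa> where x: "x = (p, \<kappa>)" by fastforce
  note iffs = gap_partitions_append_iff gap_compositions_append_iff m_step_append_iff
  have "move_last_part g x \<in> cancelling_pairs g i j \<and> move_last_part g x \<noteq> ([], []) \<and>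
      move_last_part g (move_last_part g x) = x \<and>
      (- 1 :: int) ^ length (fst (move_last_part g x)) = - ((- 1) ^ length (fst x))"
  proof (cases "p \<noteq> [] \<and> (\<kappa> = [] \<or> last \<kappa> < last p + g)")
    case True
    then obtain p' b where p: "p = p' @ [b]" by (metis rev_exhaust)
    show ?thesis
      using assms(1) True unfolding x p
      by (auto simp: cancelling_pairs_def bounded_gap_partitions_def iffs)
  next
    case False
    with assms(2) x have "\<kappa> \<noteq> []" by auto
    then obtain \<kappa>' a where \<kappa>: "\<kappa> = \<kappa>' @ [a]" by (metis rev_exhaust)
    show ?thesis
      using assms(1) False unfolding x \<kappa>
      by (auto simp: cancelling_pairs_def bounded_gap_partitions_def iffs)
  qed
  then show "move_last_part g x \<in> cancelling_pairs g i j"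
    and "move_last_part g x \<noteq> ([], [])"
    and "move_last_part g (move_last_part g x) = x"
    and "(- 1 :: int) ^ length (fst (move_last_part g x)) = - ((- 1) ^ length (fst x))"
    by blast+
qed

lemma signed_sum_cancelling_pairs:
  "(\<Sum>x\<in>cancelling_pairs g i j. (- 1) ^ length (fst x)) = (if i = j then 1 else (0 :: int))"
proof (cases "i = j")
  case True
  \<comment> \<open>Both lists then have sum 0, and they have positive parts.\<close>
  have "p = [] \<and> \<kappa> = []" if "(p, \<kappa>) \<in> cancelling_pairs g i j" for p \<kappa>
    using that True
    by (cases p; cases \<kappa>)
      (auto simp: cancelling_pairs_def bounded_gap_partitions_def gap_partitions_def
        partitions_def gap_compositions_def compositions_def)
  moreover have "([], []) \<in> cancelling_pairs g i j"
    using True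
    by (simp add: cancelling_pairs_def bounded_gap_partitions_def gap_partitions_def
        partitions_def gap_compositions_def compositions_def m_step_def)
  ultimately have "cancelling_pairs g i j = {([], [])}" by auto
  with True show ?thesis by simp
next
  case False
  then have ne: "x \<noteq> ([], [])" if "x \<in> cancelling_pairs g i j" for x
    using that by (auto simp: cancelling_pairs_def)
  let ?s = "\<lambda>x. (- 1 :: int) ^ length (fst x)"
  have "sum ?s (cancelling_pairs g i j) = (\<Sum>x\<in>cancelling_pairs g i j. - ?s x)"
    by (rule sum.reindex_bij_witness[of _ "move_last_part g" "move_last_part g"])
      (use ne move_last_part_sign_reversing_involution in auto)
  then have "sum ?s (cancelling_pairs g i j) = 0"
    by (simp add: sum_negf)
  with False show ?thesis by simp
qed

section \<open>The entries of the product\<close>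

lemma mu_eq_sum_bounded_gap_partitions:
  assumes "1 \<le> k"
  shows "mu g i k = (\<Sum>p | p \<in> bounded_gap_partitions g k \<and> sum_list p + k = i. (- 1) ^ length p)"
proof -
  have split_last: "\<exists>q. p = q @ [k + g] \<and> q \<in> bounded_gap_partitions g k \<and> sum_list q + k = i"
    if "p \<in> gap_partitions g" "p \<noteq> []" "sum_list p = i + g" "last p = k + g" for p
    using that
    by (cases p rule: rev_cases) (auto simp: bounded_gap_partitions_def gap_partitions_append_iff)
  show ?thesis
    unfolding mu_def M_def
    by (rule sum.reindex_bij_witness[of _ "\<lambda>p. p @ [k + g]" butlast])
      (use assms in \<open>auto simp: bounded_gap_partitions_def gap_partitions_append_iff
        dest!: split_last\<close>)
qed

lemma gamma_eq_card:
  "gamma g k j = int (card {\<kappa> \<in> gap_compositions g. m_step j \<kappa> \<and> j + sum_list \<kappa> = k})"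
proof -
  have "int (sum_list \<kappa>) = int k - int j \<longleftrightarrow> j + sum_list \<kappa> = k" for \<kappa>
    by linarith
  then show ?thesis by (simp add: gamma_def K_def)
qed

lemma lower_triangular_mu: "lower_triangular (mu g)"
  by (auto simp: lower_triangular_def mu_eq_sum_bounded_gap_partitions intro!: sum.neutral)

lemma lower_triangular_gamma: "lower_triangular (gamma g)"
  by (auto simp: lower_triangular_def gamma_eq_card)

lemma mat_prod_eq_sum:
  assumes "lower_triangular A" "1 \<le> i"
  shows "mat_prod A B i j = (\<Sum>k = 1..i. A i k * B k j)"
  unfolding mat_prod_def
  by (rule sum.mono_neutral_left)
    (use assms in \<open>auto simp: lower_triangular_def not_less[symmetric]\<close>)

lemma finite_cancelling_pairs: "finite (cancelling_pairs g i j)"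
proof -
  have "cancelling_pairs g i j \<subseteq>
      (\<Union>n\<le>i. {p \<in> compositions. sum_list p = n}) \<times> (\<Union>n\<le>i. {\<kappa> \<in> compositions. sum_list \<kappa> = n})"
    by (auto simp: cancelling_pairs_def bounded_gap_partitions_def gap_partitions_def
        partitions_def gap_compositions_def compositions_def)
  then show ?thesis
    by (rule finite_subset) (intro finite_cartesian_product finite_UN_I finite_atMost
        finite_compositions_of)
qed

text \<open>The pairs are grouped by the summation index \<open>k = j + sum_list \<kappa>\<close> of the matrix product.
  Each group is a Cartesian product, which yields one product of entries.\<close>

lemma mu_gamma_eq_signed_sum:
  assumes "1 \<le> i" "1 \<le> j"
  shows "mat_prod (mu g) (gamma g) i j = (\<Sum>x\<in>cancelling_pairs g i j. (- 1) ^ length (fst x))"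
proof -
  let ?P = "\<lambda>k. {p. p \<in> bounded_gap_partitions g k \<and> sum_list p + k = i}"
  let ?C = "\<lambda>k. {\<kappa> \<in> gap_compositions g. m_step j \<kappa> \<and> j + sum_list \<kappa> = k}"
  let ?k = "\<lambda>x :: nat list \<times> nat list. j + sum_list (snd x)"
  have "mu g i k * gamma g k j =
      (\<Sum>x | x \<in> cancelling_pairs g i j \<and> ?k x = k. (- 1) ^ length (fst x))"
    if "k \<in> {1..i}" for k
  proof -
    have "{x. x \<in> cancelling_pairs g i j \<and> ?k x = k} = ?P k \<times> ?C k"
      by (auto simp: cancelling_pairs_def)
    moreover have "(\<Sum>x\<in>?P k \<times> ?C k. (- 1 :: int) ^ length (fst x)) =
        (\<Sum>p\<in>?P k. (- 1) ^ length p) * int (card (?C k))"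
      by (simp add: sum.cartesian_product' sum_distrib_left mult.commute)
    ultimately show ?thesis
      using that by (simp add: mu_eq_sum_bounded_gap_partitions gamma_eq_card)
  qed
  then have "mat_prod (mu g) (gamma g) i j =
      (\<Sum>k = 1..i. \<Sum>x | x \<in> cancelling_pairs g i j \<and> ?k x = k. (- 1) ^ length (fst x))"
    using assms by (simp add: mat_prod_eq_sum lower_triangular_mu)
  also have "\<dots> = (\<Sum>x\<in>cancelling_pairs g i j. (- 1) ^ length (fst x))"
    by (rule sum.group[OF finite_cancelling_pairs])
      (use assms in \<open>auto simp: cancelling_pairs_def\<close>)
  finally show ?thesis .
qed

section \<open>One-sided inverses of lower-triangular matrices\<close>

text \<open>If \<open>A B = 1\<close>, then \<open>A (B A) = A\<close>, so \<open>X = B A - 1\<close> satisfies \<open>A X = 0\<close>. Forward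
  substitution gives \<open>X = 0\<close> row by row, because \<open>A i i * B i i = 1\<close> makes the
  diagonal entries of \<open>A\<close> nonzero.\<close>

lemma lower_triangular_right_inverse_imp_left_inverse:
  assumes A: "lower_triangular A" and B: "lower_triangular B"
    and AB: "\<And>i j. 1 \<le> i \<Longrightarrow> 1 \<le> j \<Longrightarrow> mat_prod A B i j = (if i = j then 1 else 0)"
    and "1 \<le> i" "1 \<le> j"
  shows "mat_prod B A i j = (if i = j then 1 else 0)"
  using \<open>1 \<le> i\<close>
proof (induction i rule: less_induct)
  case (less i)
  let ?I = "\<lambda>i. if i = j then 1 else 0 :: int"
  have AB': "(\<Sum>k = 1..i. A i k * B k l) = (if i = l then 1 else 0)" if "1 \<le> l" for l
    using AB[of i l] that less.prems A by (simp add: mat_prod_eq_sum)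
  have split: "{1..i} = insert i {1..<i}" using less.prems by auto
  have "A i i * B i i = 1"
  proof -
    have "(\<Sum>k = 1..<i. A i k * B k i) = 0"
      using B by (auto simp: lower_triangular_def intro!: sum.neutral)
    with AB'[OF less.prems] show ?thesis unfolding split by simp
  qed
  then have diag: "A i i \<noteq> 0" by auto
  \<comment> \<open>All inner sums are extended to the common range \<open>1..i\<close>, so that they can be interchanged.\<close>
  have BA: "mat_prod B A k j = (\<Sum>l = 1..i. B k l * A l j)" if "k \<in> {1..i}" for k
    using that B
    by (subst mat_prod_eq_sum) (auto simp: lower_triangular_def intro!: sum.mono_neutral_left)
  have "(\<Sum>k = 1..i. A i k * mat_prod B A k j) = (\<Sum>k = 1..i. \<Sum>l = 1..i. A i k * B k l * A l j)"
    by (simp add: BA sum_distrib_left mult.assoc)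
  also have "\<dots> = (\<Sum>l = 1..i. (\<Sum>k = 1..i. A i k * B k l) * A l j)"
    by (subst sum.swap) (simp add: sum_distrib_right)
  also have "\<dots> = (\<Sum>l = 1..i. if i = l then A l j else 0)"
    by (intro sum.cong refl, subst AB') auto
  also have "\<dots> = A i j"
    using less.prems by simp
  also have "\<dots> = (\<Sum>k = 1..i. A i k * ?I k)"
    using A less.prems \<open>1 \<le> j\<close> by (simp add: lower_triangular_def if_distrib cong: if_cong)
  finally have "A i i * mat_prod B A i j = A i i * ?I i"
    unfolding split by (simp add: less.IH)
  with diag show ?case by simp
qed

theorem theorem1p4:
  fixes g :: nat
  assumes "1 \<le> g"
  shows "lower_triangular (mu g) \<and> lower_triangular (gamma g) \<and>
         mutually_inverse (mu g) (gamma g)"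
proof -
  have right: "mat_prod (mu g) (gamma g) i j = (if i = j then 1 else 0)"
    if "1 \<le> i" "1 \<le> j" for i j
    using that by (simp add: mu_gamma_eq_signed_sum signed_sum_cancelling_pairs)
  then have "mat_prod (gamma g) (mu g) i j = (if i = j then 1 else 0)"
    if "1 \<le> i" "1 \<le> j" for i j
    using that lower_triangular_right_inverse_imp_left_inverse
      [OF lower_triangular_mu lower_triangular_gamma] by blast
  with right show ?thesis
    by (simp add: mutually_inverse_def lower_triangular_mu lower_triangular_gamma)
qed

end
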